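(* Let $r,D\ge 1$ be integers. For any $1\le t\le r-1$ and $1\le j\le r$ such that $t+(D+1)r+j\equiv 1\pmod 2$, we have $$I_{j,t}=\int_0^1\Phi_{j,t}(x)\,dx=0.$$
   Context: The falling factorial is $(y)_N=y(y-1)\cdots(y-N+1)$. For $1\le j\le r$, $0\le\ell\le r-1$ let $A_{j,\ell}(x)=(-1)^{r-1}\sum_{s=0}^{\ell}(-1)^s\binom rs(x+\ell-s)^{j-1}$ (with $(\cdot)^0=1$). For $1\le t\le r-1$ let $S_t(x)=(x-r)\left(x-\frac r2\right)^{t-1}(Dx)_{Dr}$. For $1\le j\le r$, $1\le t\le r-1$ let $\Phi_{j,t}(x)=A_{j,0}(x)S_t(x)+A_{j,1}(x)S_t(x+1)+\cdots+A_{j,r-1}(x)S_t(x+r-1)$. *)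

theory Defs
  imports "HOL-Analysis.Analysis" "HOL-Number_Theory.Cong"
begin

definition falling_factorial :: "real \<Rightarrow> nat \<Rightarrow> real" where
  "falling_factorial y N = (\<Prod>i<N. y - real i)"

(* The parameters r, and D where needed, come first. All natural number subtractions below
   are meant for r, j, t at least 1. The library's 0 ^ 0 = 1 is the convention used for j = 1. *)

definition A_poly :: "nat \<Rightarrow> nat \<Rightarrow> nat \<Rightarrow> real \<Rightarrow> real" where
  "A_poly r j l x =
     (- 1) ^ (r - 1) * (\<Sum>s=0..l. (- 1) ^ s * real (r choose s) * (x + real l - real s) ^ (j - 1))"

definition S_poly :: "nat \<Rightarrow> nat \<Rightarrow> nat \<Rightarrow> real \<Rightarrow> real" where
  "S_poly r D t x =
     (x - real r) * (x - real r / 2) ^ (t - 1) * falling_factorial (real D * x) (D * r)"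

definition Phi :: "nat \<Rightarrow> nat \<Rightarrow> nat \<Rightarrow> nat \<Rightarrow> real \<Rightarrow> real" where
  "Phi r D j t x = (\<Sum>l=0..r-1. A_poly r j l x * S_poly r D t (x + real l))"

definition I_int :: "nat \<Rightarrow> nat \<Rightarrow> nat \<Rightarrow> nat \<Rightarrow> real" where
  "I_int r D j t = integral {0..1} (Phi r D j t)"

(* Integrability, so that I_int is a genuine integral and not the default value 0. *)
lemma Phi_has_integral: "(Phi r D j t has_integral I_int r D j t) {0..1}"
proof -
  have "continuous_on {0..1} (\<lambda>x. Phi r D j t x)"
    unfolding Phi_def A_poly_def S_poly_def falling_factorial_def
    by (intro continuous_intros)
  then show ?thesis
    unfolding I_int_def by (intro integrable_integral integrable_continuous_real) simp
qed

end

theory Submission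
  imports Defs
begin

text \<open>
  The integrand is antisymmetric about 1/2: the finite difference of order r annihilates
  polynomials of degree below r, so the truncated sums \<open>A\<^sub>j\<^sub>,\<^sub>l\<close> and their complements agree up to
  sign, and \<open>D S\<^sub>t(x) = (x - r/2)\<^bsup>t-1\<^esup> (Dx)\<^bsub>Dr+1\<^esub>\<close> has a definite parity about \<open>r/2\<close>.
\<close>

text \<open>Induction on \<open>m\<close>, splitting off one factor \<open>y - real s\<close>. Its
  \<open>y\<close> part vanishes by the induction hypothesis; its \<open>s\<close> part drops to
  order \<open>r - 1\<close> at \<open>y - 1\<close>, hence the generalisation over \<open>r\<close>
  and \<open>y\<close>.\<close>

lemma alternating_binomial_sum_power_eq_0:
  fixes y :: real
  assumes "m < r"
  shows "(\<Sum>s\<le>r. (- 1) ^ s * real (r choose s) * (y - real s) ^ m) = 0"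
  using assms
proof (induction m arbitrary: r y)
  case 0
  then show ?case
    using choose_alternating_sum[of r, where 'a = real] by simp
next
  case (Suc m)
  then obtain q where r: "r = Suc q" and q: "m < q"
    by (cases r) auto
  let ?f = "\<lambda>s. (- 1) ^ s * real (r choose s) * (y - real s) ^ m"
  \<comment> \<open>The factor \<open>real s\<close> kills the term at 0; on the remaining terms,
    absorbing it into the binomial coefficient lowers the order from \<open>r\<close> to
    \<open>q\<close>.\<close>
  have "(\<Sum>s\<le>r. real s * ?f s) = (\<Sum>s\<le>q. real (Suc s) * ?f (Suc s))"
    unfolding r sum.atMost_Suc_shift by simp
  also have "\<dots> = - real r * (\<Sum>s\<le>q. (- 1) ^ s * real (q choose s) * ((y - 1) - real s) ^ m)"
    unfolding sum_distrib_left
  proof (rule sum.cong)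
    fix s
    have "real (Suc s) * real (r choose Suc s) = real r * real (q choose s)"
      unfolding r by (metis Suc_times_binomial of_nat_mult)
    moreover have "y - real (Suc s) = (y - 1) - real s"
      by simp
    moreover have "real (Suc s) * ?f (Suc s) =
        - (real (Suc s) * real (r choose Suc s)) * ((- 1) ^ s * (y - real (Suc s)) ^ m)"
      by simp
    ultimately show "real (Suc s) * ?f (Suc s) =
        - real r * ((- 1) ^ s * real (q choose s) * ((y - 1) - real s) ^ m)"
      by (simp only: mult_minus_left mult_minus_right mult_ac)
  qed simp
  also have "\<dots> = 0"
    using Suc.IH[OF q] by simp
  finally have "(\<Sum>s\<le>r. real s * ?f s) = 0" .
  moreover have "(\<Sum>s\<le>r. ?f s) = 0"
    using Suc.IH[of r y] Suc.prems by simp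
  moreover have "(\<Sum>s\<le>r. (- 1) ^ s * real (r choose s) * (y - real s) ^ Suc m) =
      y * (\<Sum>s\<le>r. ?f s) - (\<Sum>s\<le>r. real s * ?f s)"
    unfolding sum_distrib_left sum_subtractf[symmetric]
    by (rule sum.cong) (simp_all add: algebra_simps)
  ultimately show ?case
    by simp
qed

text \<open>As \<open>j - 1 < r\<close>, the full alternating sum is zero, so the sum up to
  \<open>l\<close> is minus its tail. The substitution of \<open>r - s\<close> for \<open>s\<close>
  turns the tail into the truncated sum for \<open>r - 1 - l\<close> at
  \<open>1 - x\<close>.\<close>

lemma A_poly_reflect:
  assumes "l < r" and "1 \<le> j" and "j \<le> r"
  shows "A_poly r j (r - 1 - l) (1 - x) = (- 1) ^ (r + j) * A_poly r j l x"
proof -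
  let ?g = "\<lambda>s. (- 1) ^ s * real (r choose s) * (x + real l - real s) ^ (j - 1)"
  have "{..r} = {0..l} \<union> {Suc l..r}" and "{0..l} \<inter> {Suc l..r} = {}"
    using assms by auto
  then have "sum ?g {0..l} + sum ?g {Suc l..r} = 0"
    using alternating_binomial_sum_power_eq_0[of "j - 1" r "x + real l"] assms
    by (simp add: sum.union_disjoint)
  moreover have "sum ?g {Suc l..r} = (\<Sum>s=0..r-1-l. ?g (r - s))"
    by (rule sum.reindex_bij_witness[of _ "\<lambda>s. r - s" "\<lambda>s. r - s"]) (use assms in auto)
  \<comment> \<open>The sign collects \<open>(- 1) ^ r\<close> from the alternation and
    \<open>(- 1) ^ (j - 1)\<close> from the base, which changes sign under the substitution.\<close>
  moreover have "?g (r - s) = (- 1) ^ (r + j - 1) *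
      ((- 1) ^ s * real (r choose s) * ((1 - x) + real (r - 1 - l) - real s) ^ (j - 1))"
    if "s \<in> {0..r-1-l}" for s
  proof -
    let ?z = "(1 - x) + real (r - 1 - l) - real s"
    have le: "s \<le> r"
      using that by auto
    have "x + real l - real (r - s) = - ?z"
      using that assms by (auto simp: of_nat_diff)
    then have "(x + real l - real (r - s)) ^ (j - 1) = (- 1) ^ (j - 1) * ?z ^ (j - 1)"
      by (metis power_minus)
    moreover have "(- 1 :: real) ^ (r - s) = (- 1) ^ r * (- 1) ^ s"
      using le by (auto simp: minus_one_power_iff)
    moreover have "(- 1 :: real) ^ (r + j - 1) = (- 1) ^ r * (- 1) ^ (j - 1)"
      using assms by (simp flip: power_add)
    ultimately show ?thesis
      using binomial_symmetric[OF le] by (simp only: mult_ac)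
  qed
  ultimately have "sum ?g {0..l} = - ((- 1) ^ (r + j - 1)) *
      (\<Sum>s=0..r-1-l. (- 1) ^ s * real (r choose s) * ((1 - x) + real (r - 1 - l) - real s) ^ (j - 1))"
    by (simp add: sum_distrib_left sum_negf eq_neg_iff_add_eq_0)
  moreover have "- ((- 1 :: real) ^ (r + j - 1)) = (- 1) ^ (r + j)"
    using assms by (auto simp: minus_one_power_iff)
  \<comment> \<open>The sum at \<open>x\<close> is now a sign times the one at \<open>1 - x\<close>;
    the sign squares to 1, so the relation can be inverted.\<close>
  moreover have "(- 1 :: real) ^ (r + j) * (c * ((- 1) ^ (r + j) * z)) = c * z" for c z
    by (simp add: minus_one_power_iff)
  ultimately show ?thesis
    unfolding A_poly_def by (simp only:)
qed

text \<open>The roots 0, ..., N are symmetric about N/2, so the reflection permutes the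
  \<open>Suc N\<close> factors, each up to a sign.\<close>

lemma falling_factorial_reflect:
  "falling_factorial (real N - y) (Suc N) = (- 1) ^ Suc N * falling_factorial y (Suc N)"
proof -
  have "falling_factorial (real N - y) (Suc N) = (\<Prod>i<Suc N. real N - y - real (N - i))"
    unfolding falling_factorial_def
    by (rule prod.reindex_bij_witness[of _ "\<lambda>i. N - i" "\<lambda>i. N - i"]) auto
  also have "\<dots> = (\<Prod>i<Suc N. - 1 * (y - real i))"
    by (rule prod.cong) (auto simp: of_nat_diff)
  finally show ?thesis
    unfolding falling_factorial_def prod.distrib by simp
qed

text \<open>The factor \<open>x - real r\<close>, scaled by \<open>D\<close>, is the next factor of
  the falling factorial. It completes the roots to 0, 1/D, ..., r, which are symmetric about
  r/2.\<close>

lemma S_poly_eq: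
  assumes "D \<ge> 1"
  shows "real D * S_poly r D t x =
    (x - real r / 2) ^ (t - 1) * falling_factorial (real D * x) (Suc (D * r))"
  unfolding S_poly_def falling_factorial_def by (simp add: algebra_simps)

lemma S_poly_reflect:
  assumes "D \<ge> 1" and "t \<ge> 1"
  shows "S_poly r D t (real r - x) = (- 1) ^ (t + D * r) * S_poly r D t x"
proof -
  have "real r - x - real r / 2 = - (x - real r / 2)"
    by simp
  then have power: "(real r - x - real r / 2) ^ (t - 1) = (- 1) ^ (t - 1) * (x - real r / 2) ^ (t - 1)"
    by (metis power_minus)
  have "real D * (real r - x) = real (D * r) - real D * x"
    by (simp add: algebra_simps)
  \<comment> \<open>The power contributes t - 1 signs and the falling factorial Dr + 1. The scaling
    by \<open>D\<close> is cancelled at the end, as \<open>D\<close> is nonzero.\<close>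
  then have "real D * S_poly r D t (real r - x) =
      (- 1) ^ (t - 1) * (- 1) ^ Suc (D * r) * (real D * S_poly r D t x)"
    unfolding S_poly_eq[OF assms(1)] power by (simp only: falling_factorial_reflect mult_ac)
  also have "(- 1 :: real) ^ (t - 1) * (- 1) ^ Suc (D * r) = (- 1) ^ (t + D * r)"
    using assms(2) by (auto simp: minus_one_power_iff)
  finally have "real D * S_poly r D t (real r - x) = real D * ((- 1) ^ (t + D * r) * S_poly r D t x)"
    by (simp only: mult_ac)
  then show ?thesis
    using assms(1) by (simp only: mult_cancel_left) simp
qed

text \<open>Reversing the sum pairs \<open>l\<close> with \<open>r - 1 - l\<close>. As (1 - x) + (r
  - 1 - l) = r - (x + l), both factors of each term reflect at once, with exponents r + j and t +
  Dr.\<close>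

lemma Phi_reflect:
  assumes "D \<ge> 1" and "t \<ge> 1" and "1 \<le> j" and "j \<le> r"
  shows "Phi r D j t (1 - x) = (- 1) ^ (t + (D + 1) * r + j) * Phi r D j t x"
proof -
  have "Phi r D j t (1 - x) =
      (\<Sum>l=0..r-1. A_poly r j (r - 1 - l) (1 - x) * S_poly r D t (1 - x + real (r - 1 - l)))"
    unfolding Phi_def
    using sum.atLeastAtMost_rev[of "\<lambda>l. A_poly r j l (1 - x) * S_poly r D t (1 - x + real l)" 0 "r - 1"]
    by simp
  also have "\<dots> = (\<Sum>l=0..r-1. (- 1) ^ (t + (D + 1) * r + j) *
      (A_poly r j l x * S_poly r D t (x + real l)))"
  proof (rule sum.cong)
    fix l assume "l \<in> {0..r-1}"
    then have l: "l < r"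
      using assms by auto
    then have "1 - x + real (r - 1 - l) = real r - (x + real l)"
      by (simp add: of_nat_diff)
    then show "A_poly r j (r - 1 - l) (1 - x) * S_poly r D t (1 - x + real (r - 1 - l)) =
        (- 1) ^ (t + (D + 1) * r + j) * (A_poly r j l x * S_poly r D t (x + real l))"
      using A_poly_reflect[OF l assms(3,4)] S_poly_reflect[OF assms(1,2)]
      by (simp add: power_add algebra_simps)
  qed simp
  finally show ?thesis
    unfolding Phi_def sum_distrib_left .
qed

theorem proposition2p16:
  fixes r D j t :: nat
  assumes "r \<ge> 1" and "D \<ge> 1"
    and "1 \<le> t" and "t \<le> r - 1"
    and "1 \<le> j" and "j \<le> r"
    and "[t + (D + 1) * r + j = 1] (mod 2)"
  shows "I_int r D j t = 0"
proof -
  have "odd (t + (D + 1) * r + j)"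
    using assms(7) by (metis cong_def odd_iff_mod_2_eq_one one_mod_two_eq_one)
  then have "Phi r D j t (1 - x) = - Phi r D j t x" for x
    using Phi_reflect[OF assms(2,3,5,6), of x] by (simp only: power_minus_odd) simp
  \<comment> \<open>The substitution of \<open>1 - x\<close> for \<open>x\<close> maps the unit
    interval onto itself and has scaling factor 1 in absolute value.\<close>
  moreover have "((\<lambda>x. Phi r D j t (1 - x)) has_integral I_int r D j t) {0..1}"
    using has_integral_affinity[OF Phi_has_integral[of r D j t, folded cbox_interval],
        of "- 1" 1] by (simp add: image_affinity_cbox)
  ultimately have "((\<lambda>x. - Phi r D j t x) has_integral I_int r D j t) {0..1}"
    by simp
  then have "I_int r D j t = - I_int r D j t"
    using has_integral_neg[OF Phi_has_integral] by (rule has_integral_unique)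
  then show ?thesis
    by simp
qed

end
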